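(* Let $T$ be a truss and let $Z$ be the truss on the singleton set $\{0\}$. Then the multiplication $\cdot$ on $T\boxplus Z$ given on the generating elements $T\sqcup\{0\}$ by $$0\cdot t=t\cdot 0=0,\qquad t\cdot t'=tt',\qquad 0\cdot 0=0\qquad (t,t'\in T),$$ where $tt'$ is the product in $T$, and extended to all of $T\boxplus Z$ by distributivity over the heap operation, is well defined and makes $T\boxplus Z$ into a ring-type truss (with absorber $0$).
   Context: A heap is a set $H$ (possibly empty) with a ternary operation $[-,-,-]$ such that $[[a,b,c],d,e]=[a,b,[c,d,e]]$ and $[a,b,b]=a=[b,b,a]$ for all $a,b,c,d,e\in H$. It is Abelian if $[a,b,c]=[c,b,a]$. A truss is an Abelian heap $T$ with an associative binary multiplication satisfying $s[t,t',t'']=[st,st',st'']$ and $[t,t',t'']s=[ts,t's,t''s]$ for all $s,t,t',t''\in T$. A truss is ring-type if it has an element $0$ (an absorber) with $t0=0t=0$ for all elements $t$. $T\boxplus Z$ denotes the direct sum (coproduct in the category of Abelian heaps) of the underlying Abelian heaps of $T$ and $Z$; $T$ and $\{0\}$ are identified with their images in $T\boxplus Z$, and the heap $T\boxplus Z$ is generated by $T\sqcup\{0\}$. *)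

theory Defs
  imports Main
begin

section \<open>Heaps and trusses\<close>

locale heap =
  fixes H :: "'a set" and br :: "'a \<Rightarrow> 'a \<Rightarrow> 'a \<Rightarrow> 'a"
  assumes br_closed: "\<lbrakk>a \<in> H; b \<in> H; c \<in> H\<rbrakk> \<Longrightarrow> br a b c \<in> H"
    and br_assoc: "\<lbrakk>a \<in> H; b \<in> H; c \<in> H; d \<in> H; e \<in> H\<rbrakk>
      \<Longrightarrow> br (br a b c) d e = br a b (br c d e)"
    and br_right: "\<lbrakk>a \<in> H; b \<in> H\<rbrakk> \<Longrightarrow> br a b b = a"
    and br_left: "\<lbrakk>a \<in> H; b \<in> H\<rbrakk> \<Longrightarrow> br b b a = a"

locale abelian_heap = heap +
  assumes br_comm: "\<lbrakk>a \<in> H; b \<in> H; c \<in> H\<rbrakk> \<Longrightarrow> br a b c = br c b a"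

definition heap_hom ::
  "'a set \<Rightarrow> ('a \<Rightarrow> 'a \<Rightarrow> 'a \<Rightarrow> 'a) \<Rightarrow> 'b set \<Rightarrow> ('b \<Rightarrow> 'b \<Rightarrow> 'b \<Rightarrow> 'b) \<Rightarrow> ('a \<Rightarrow> 'b) \<Rightarrow> bool"
  where "heap_hom A brA B brB f \<longleftrightarrow> (\<forall>a\<in>A. f a \<in> B) \<and>
    (\<forall>a\<in>A. \<forall>b\<in>A. \<forall>c\<in>A. f (brA a b c) = brB (f a) (f b) (f c))"

text \<open>An Abelian heap with a binary operation distributing over the heap operation,
  not assumed associative.\<close>

locale distributive_heap = abelian_heap T br
  for T :: "'a set" and br :: "'a \<Rightarrow> 'a \<Rightarrow> 'a \<Rightarrow> 'a" +
  fixes mul :: "'a \<Rightarrow> 'a \<Rightarrow> 'a"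
  assumes mul_closed: "\<lbrakk>s \<in> T; t \<in> T\<rbrakk> \<Longrightarrow> mul s t \<in> T"
    and distrib_left: "\<lbrakk>s \<in> T; t \<in> T; t' \<in> T; t'' \<in> T\<rbrakk>
      \<Longrightarrow> mul s (br t t' t'') = br (mul s t) (mul s t') (mul s t'')"
    and distrib_right: "\<lbrakk>s \<in> T; t \<in> T; t' \<in> T; t'' \<in> T\<rbrakk>
      \<Longrightarrow> mul (br t t' t'') s = br (mul t s) (mul t' s) (mul t'' s)"

locale truss = distributive_heap +
  assumes mul_assoc: "\<lbrakk>s \<in> T; t \<in> T; u \<in> T\<rbrakk> \<Longrightarrow> mul (mul s t) u = mul s (mul t u)"

definition absorber :: "'a set \<Rightarrow> ('a \<Rightarrow> 'a \<Rightarrow> 'a) \<Rightarrow> 'a \<Rightarrow> bool"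
  where "absorber T mul z \<longleftrightarrow> z \<in> T \<and> (\<forall>t\<in>T. mul t z = z \<and> mul z t = z)"

locale ring_type_truss = truss +
  assumes ex_absorber: "\<exists>z. absorber T mul z"


section \<open>The direct sum of two Abelian heaps\<close>

text \<open>The coproduct is presented by generators and relations: formal heap expressions in
  the disjoint union of the two carriers, modulo the least congruence that contains the axioms
  of Abelian heaps and the values of the two given heap operations.\<close>

datatype (gens: 'x) hterm = Gen 'x | Br "'x hterm" "'x hterm" "'x hterm"

definition hterms :: "'x set \<Rightarrow> 'x hterm set"
  where "hterms X = {t. gens t \<subseteq> X}"

inductive dsum_eq ::
  "'a set \<Rightarrow> ('a \<Rightarrow> 'a \<Rightarrow> 'a \<Rightarrow> 'a) \<Rightarrow> 'b set \<Rightarrow> ('b \<Rightarrow> 'b \<Rightarrow> 'b \<Rightarrow> 'b)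
    \<Rightarrow> ('a + 'b) hterm \<Rightarrow> ('a + 'b) hterm \<Rightarrow> bool"
  for A brA B brB where
  refl: "t \<in> hterms (A <+> B) \<Longrightarrow> dsum_eq A brA B brB t t"
| sym: "dsum_eq A brA B brB s t \<Longrightarrow> dsum_eq A brA B brB t s"
| trans: "\<lbrakk>dsum_eq A brA B brB s t; dsum_eq A brA B brB t u\<rbrakk> \<Longrightarrow> dsum_eq A brA B brB s u"
| cong: "\<lbrakk>dsum_eq A brA B brB s s'; dsum_eq A brA B brB t t'; dsum_eq A brA B brB u u'\<rbrakk>
    \<Longrightarrow> dsum_eq A brA B brB (Br s t u) (Br s' t' u')"
| assoc: "\<lbrakk>r \<in> hterms (A <+> B); s \<in> hterms (A <+> B); t \<in> hterms (A <+> B);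
      u \<in> hterms (A <+> B); v \<in> hterms (A <+> B)\<rbrakk>
    \<Longrightarrow> dsum_eq A brA B brB (Br (Br r s t) u v) (Br r s (Br t u v))"
| right: "\<lbrakk>s \<in> hterms (A <+> B); t \<in> hterms (A <+> B)\<rbrakk>
    \<Longrightarrow> dsum_eq A brA B brB (Br s t t) s"
| left: "\<lbrakk>s \<in> hterms (A <+> B); t \<in> hterms (A <+> B)\<rbrakk>
    \<Longrightarrow> dsum_eq A brA B brB (Br t t s) s"
| comm: "\<lbrakk>s \<in> hterms (A <+> B); t \<in> hterms (A <+> B); u \<in> hterms (A <+> B)\<rbrakk>
    \<Longrightarrow> dsum_eq A brA B brB (Br s t u) (Br u t s)"
| inl: "\<lbrakk>a \<in> A; b \<in> A; c \<in> A\<rbrakk> \<Longrightarrow>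
    dsum_eq A brA B brB (Br (Gen (Inl a)) (Gen (Inl b)) (Gen (Inl c))) (Gen (Inl (brA a b c)))"
| inr: "\<lbrakk>a \<in> B; b \<in> B; c \<in> B\<rbrakk> \<Longrightarrow>
    dsum_eq A brA B brB (Br (Gen (Inr a)) (Gen (Inr b)) (Gen (Inr c))) (Gen (Inr (brB a b c)))"

definition dsum_rel ::
  "'a set \<Rightarrow> ('a \<Rightarrow> 'a \<Rightarrow> 'a \<Rightarrow> 'a) \<Rightarrow> 'b set \<Rightarrow> ('b \<Rightarrow> 'b \<Rightarrow> 'b \<Rightarrow> 'b)
    \<Rightarrow> (('a + 'b) hterm \<times> ('a + 'b) hterm) set"
  where "dsum_rel A brA B brB = {(s, t). dsum_eq A brA B brB s t}"

definition dsum ::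
  "'a set \<Rightarrow> ('a \<Rightarrow> 'a \<Rightarrow> 'a \<Rightarrow> 'a) \<Rightarrow> 'b set \<Rightarrow> ('b \<Rightarrow> 'b \<Rightarrow> 'b \<Rightarrow> 'b) \<Rightarrow> ('a + 'b) hterm set set"
  where "dsum A brA B brB = hterms (A <+> B) // dsum_rel A brA B brB"

definition dsum_br ::
  "'a set \<Rightarrow> ('a \<Rightarrow> 'a \<Rightarrow> 'a \<Rightarrow> 'a) \<Rightarrow> 'b set \<Rightarrow> ('b \<Rightarrow> 'b \<Rightarrow> 'b \<Rightarrow> 'b)
    \<Rightarrow> ('a + 'b) hterm set \<Rightarrow> ('a + 'b) hterm set \<Rightarrow> ('a + 'b) hterm set \<Rightarrow> ('a + 'b) hterm set"
  where "dsum_br A brA B brB x y z =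
    (\<Union>s\<in>x. \<Union>t\<in>y. \<Union>u\<in>z. dsum_rel A brA B brB `` {Br s t u})"

definition dsum_inl ::
  "'a set \<Rightarrow> ('a \<Rightarrow> 'a \<Rightarrow> 'a \<Rightarrow> 'a) \<Rightarrow> 'b set \<Rightarrow> ('b \<Rightarrow> 'b \<Rightarrow> 'b \<Rightarrow> 'b) \<Rightarrow> 'a \<Rightarrow> ('a + 'b) hterm set"
  where "dsum_inl A brA B brB a = dsum_rel A brA B brB `` {Gen (Inl a)}"

definition dsum_inr ::
  "'a set \<Rightarrow> ('a \<Rightarrow> 'a \<Rightarrow> 'a \<Rightarrow> 'a) \<Rightarrow> 'b set \<Rightarrow> ('b \<Rightarrow> 'b \<Rightarrow> 'b \<Rightarrow> 'b) \<Rightarrow> 'b \<Rightarrow> ('a + 'b) hterm set"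
  where "dsum_inr A brA B brB b = dsum_rel A brA B brB `` {Gen (Inr b)}"


subsection \<open>The construction is the coproduct\<close>

locale two_abelian_heaps =
  A: abelian_heap A brA + B: abelian_heap B brB
  for A :: "'a set" and brA and B :: "'b set" and brB
begin

abbreviation W where "W \<equiv> hterms (A <+> B)"
abbreviation D where "D \<equiv> dsum A brA B brB"
abbreviation cls where "cls t \<equiv> dsum_rel A brA B brB `` {t}"
abbreviation brD where "brD \<equiv> dsum_br A brA B brB"
abbreviation il where "il \<equiv> dsum_inl A brA B brB"
abbreviation ir where "ir \<equiv> dsum_inr A brA B brB"

lemma Gen_W [simp]:
  "Gen (Inl a) \<in> W \<longleftrightarrow> a \<in> A" "Gen (Inr b) \<in> W \<longleftrightarrow> b \<in> B"
  by (auto simp: hterms_def)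

lemma Br_W [simp]: "Br s t u \<in> W \<longleftrightarrow> s \<in> W \<and> t \<in> W \<and> u \<in> W"
  by (auto simp: hterms_def)

lemma dsum_eq_W: "dsum_eq A brA B brB s t \<Longrightarrow> s \<in> W \<and> t \<in> W"
  by (induction rule: dsum_eq.induct) (auto simp: A.br_closed B.br_closed)

lemma equiv_rel: "equiv W (dsum_rel A brA B brB)"
  by (rule equivI)
    (auto simp: dsum_rel_def refl_on_def sym_def trans_def dest: dsum_eq_W
      intro: dsum_eq.refl dsum_eq.sym dsum_eq.trans)

lemma cls_eq_iff: "\<lbrakk>s \<in> W; t \<in> W\<rbrakk> \<Longrightarrow> cls s = cls t \<longleftrightarrow> dsum_eq A brA B brB s t"
  using eq_equiv_class_iff[OF equiv_rel] by (simp add: dsum_rel_def)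

lemma cls_D: "t \<in> W \<Longrightarrow> cls t \<in> D"
  by (simp add: dsum_def quotientI)

lemma D_cases: assumes "x \<in> D" obtains t where "t \<in> W" "x = cls t"
  using assms unfolding dsum_def by (rule quotientE)

lemma brD_cls:
  assumes "s \<in> W" "t \<in> W" "u \<in> W"
  shows "brD (cls s) (cls t) (cls u) = cls (Br s t u)"
proof -
  have "cls (Br s' t' u') = cls (Br s t u)" if "s' \<in> cls s" "t' \<in> cls t" "u' \<in> cls u" for s' t' u'
  proof -
    have "dsum_eq A brA B brB (Br s t u) (Br s' t' u')"
      using that by (auto simp: dsum_rel_def intro: dsum_eq.cong)
    then show ?thesis
      using cls_eq_iff dsum_eq_W by metis
  qed
  moreover have "s \<in> cls s" "t \<in> cls t" "u \<in> cls u"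
    using assms by (auto simp: dsum_rel_def intro: dsum_eq.refl)
  ultimately show ?thesis
    unfolding dsum_br_def by blast
qed

theorem abelian_heap_dsum: "abelian_heap D brD"
proof
  fix a b c d e
  show "brD a b c \<in> D" if "a \<in> D" "b \<in> D" "c \<in> D"
    using that by (elim D_cases) (simp add: brD_cls cls_D)
  show "brD (brD a b c) d e = brD a b (brD c d e)"
    if "a \<in> D" "b \<in> D" "c \<in> D" "d \<in> D" "e \<in> D"
    using that by (elim D_cases) (simp add: brD_cls cls_eq_iff dsum_eq.assoc)
  show "brD a b b = a" if "a \<in> D" "b \<in> D"
    using that by (elim D_cases) (simp add: brD_cls cls_eq_iff dsum_eq.right)
  show "brD b b a = a" if "a \<in> D" "b \<in> D"
    using that by (elim D_cases) (simp add: brD_cls cls_eq_iff dsum_eq.left)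
  show "brD a b c = brD c b a" if "a \<in> D" "b \<in> D" "c \<in> D"
    using that by (elim D_cases) (simp add: brD_cls cls_eq_iff dsum_eq.comm)
qed

theorem heap_hom_inl: "heap_hom A brA D brD il"
  by (simp add: heap_hom_def dsum_inl_def cls_D brD_cls cls_eq_iff A.br_closed
      dsum_eq.sym[OF dsum_eq.inl])

theorem heap_hom_inr: "heap_hom B brB D brD ir"
  by (simp add: heap_hom_def dsum_inr_def cls_D brD_cls cls_eq_iff B.br_closed
      dsum_eq.sym[OF dsum_eq.inr])

theorem dsum_induct [consumes 1, case_names inl inr br]:
  assumes "x \<in> D"
    and "\<And>a. a \<in> A \<Longrightarrow> P (il a)"
    and "\<And>b. b \<in> B \<Longrightarrow> P (ir b)"
    and br: "\<And>x y z. \<lbrakk>x \<in> D; y \<in> D; z \<in> D; P x; P y; P z\<rbrakk> \<Longrightarrow> P (brD x y z)"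
  shows "P x"
proof -
  have "P (cls t)" if "t \<in> W" for t
    using that
  proof (induction t)
    case (Gen x)
    then show ?case
      using assms(2,3) by (cases x) (simp_all add: dsum_inl_def dsum_inr_def)
  next
    case (Br s t u)
    then have "P (brD (cls s) (cls t) (cls u))"
      by (intro br) (simp_all add: cls_D)
    then show ?case using Br.prems by (simp add: brD_cls)
  qed
  then show ?thesis using assms(1) by (metis D_cases)
qed

primrec heval :: "('c \<Rightarrow> 'c \<Rightarrow> 'c \<Rightarrow> 'c) \<Rightarrow> ('x \<Rightarrow> 'c) \<Rightarrow> 'x hterm \<Rightarrow> 'c" where
  "heval br f (Gen x) = f x"
| "heval br f (Br s t u) = br (heval br f s) (heval br f t) (heval br f u)"

theorem dsum_hom_exists:
  fixes C :: "'c set"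
  assumes C: "abelian_heap C brC"
    and f: "heap_hom A brA C brC f" and g: "heap_hom B brB C brC g"
  shows "\<exists>h. heap_hom D brD C brC h \<and> (\<forall>a\<in>A. h (il a) = f a) \<and> (\<forall>b\<in>B. h (ir b) = g b)"
proof -
  interpret C: abelian_heap C brC by (rule C)
  let ?e = "heval brC (case_sum f g)"
  have e_C: "?e t \<in> C" if "t \<in> W" for t
    using that
  proof (induction t)
    case (Gen x)
    then show ?case using f g by (cases x) (simp_all add: heap_hom_def)
  qed (simp add: C.br_closed)
  have e_eq: "?e s = ?e t" if "dsum_eq A brA B brB s t" for s t
    using that
  proof (induction rule: dsum_eq.induct)
    case (comm s t u)
    then show ?case using e_C C.br_comm[of "?e s" "?e t" "?e u"] by simp
  qed (use f g in \<open>auto simp: heap_hom_def e_C C.br_assoc C.br_right C.br_left\<close>)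
  define h where "h x = ?e (SOME t. t \<in> x)" for x
  have h_cls: "h (cls t) = ?e t" if "t \<in> W" for t
  proof -
    have "t \<in> cls t" using that by (simp add: dsum_rel_def dsum_eq.refl)
    then have "(SOME s. s \<in> cls t) \<in> cls t" by (rule someI)
    then show ?thesis unfolding h_def by (simp add: dsum_rel_def e_eq[symmetric])
  qed
  have hom: "heap_hom D brD C brC h"
    unfolding heap_hom_def by (auto elim!: D_cases simp: h_cls e_C brD_cls)
  have hl: "h (il a) = f a" if "a \<in> A" for a
    using that by (simp add: dsum_inl_def h_cls)
  have hr: "h (ir b) = g b" if "b \<in> B" for b
    using that by (simp add: dsum_inr_def h_cls)
  from hom hl hr show ?thesis by blast
qed

theorem dsum_hom_unique:
  assumes h: "heap_hom D brD C brC h" and h': "heap_hom D brD C brC h'"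
    and "\<And>a. a \<in> A \<Longrightarrow> h (il a) = h' (il a)" and "\<And>b. b \<in> B \<Longrightarrow> h (ir b) = h' (ir b)"
    and "x \<in> D"
  shows "h x = h' x"
  using \<open>x \<in> D\<close>
proof (induction rule: dsum_induct)
  case (br x y z)
  then show ?case using h h' by (simp add: heap_hom_def)
qed (use assms in simp_all)

theorem inj_on_inl: "inj_on il A"
proof (rule inj_onI)
  fix a a' assume a: "a \<in> A" "a' \<in> A" and eq: "il a = il a'"
  have "heap_hom A brA A brA id" "heap_hom B brB A brA (\<lambda>_. a)"
    by (simp_all add: heap_hom_def a A.br_right)
  from dsum_hom_exists[OF A.abelian_heap_axioms this]
  obtain h where "\<forall>c\<in>A. h (il c) = id c"
    by blast
  then show "a = a'" using a eq by (metis id_apply)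
qed

theorem inj_on_inr: "inj_on ir B"
proof (rule inj_onI)
  fix b b' assume b: "b \<in> B" "b' \<in> B" and eq: "ir b = ir b'"
  have "heap_hom A brA B brB (\<lambda>_. b)" "heap_hom B brB B brB id"
    by (simp_all add: heap_hom_def b B.br_right)
  from dsum_hom_exists[OF B.abelian_heap_axioms this]
  obtain h where "\<forall>c\<in>B. h (ir c) = id c"
    by blast
  then show "b = b'" using b eq by (metis id_apply)
qed

theorem inl_neq_inr: assumes "a \<in> A" "b \<in> B" shows "il a \<noteq> ir b"
proof -
  let ?br = "\<lambda>x y z :: int. x - y + z"
  have Z: "abelian_heap UNIV ?br"
    by unfold_locales simp_all
  have "heap_hom A brA UNIV ?br (\<lambda>_. 0)" "heap_hom B brB UNIV ?br (\<lambda>_. 1)"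
    by (simp_all add: heap_hom_def)
  from dsum_hom_exists[OF Z this] obtain h :: "('a + 'b) hterm set \<Rightarrow> int"
    where "\<forall>a\<in>A. h (il a) = 0" "\<forall>b\<in>B. h (ir b) = 1"
    by blast
  then show ?thesis using assms by force
qed

end

end

theory Submission
  imports Defs
begin

text \<open>
  A product that distributes over the heap operation is a map \<open>D \<times> D \<rightarrow> D\<close> that is a heap
  homomorphism in each argument, so it is built by applying the universal property of the
  coproduct \<open>D = T \<boxplus> Z\<close> to one argument at a time. The point is that the homomorphism out of a
  coproduct depends homomorphically on a parameter as soon as its two restrictions do
  (\<open>dsum_hom_exists_param\<close>); this rests on the medial law \<open>abelian_heap.br_medial\<close>, by which the heap
  operation of an Abelian heap is itself a homomorphism.

  Extending the left multiplications \<open>t' \<mapsto> t t'\<close>, \<open>0 \<mapsto> 0\<close> in this way, with parameter \<open>t \<in> T\<close>, gives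
  a map \<open>T \<times> D \<rightarrow> D\<close>. Together with the constant map \<open>0\<close> on \<open>Z \<times> D\<close> it extends in the first
  argument, now with parameter in \<open>D\<close>, to the required \<open>D \<times> D \<rightarrow> D\<close>.

  All remaining claims are identities between expressions that are homomorphisms in each variable, so
  it is enough to check them on the generators (\<open>mul_eq_on_generators\<close>,
  \<open>truss_if_assoc_on_generators\<close>). There associativity holds because a product of three generators is
  \<open>0\<close> for either bracketing if one of the factors is \<open>0\<close>, and otherwise it is a product in \<open>T\<close>.
\<close>

context abelian_heap
begin

text \<open>A right-nested expression \<open>[a, b, [c, d, e]]\<close> stands for \<open>a - b + c - d + e\<close>. The following two
  lemmas exchange the negative summands, and both pairs of summands of equal sign at once.\<close>

lemma br_swap_neg:
  assumes "a \<in> H" "b \<in> H" "c \<in> H" "d \<in> H" "e \<in> H"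
  shows "br a b (br c d e) = br a d (br c b e)"
proof -
  have "br a b (br c d e) = br (br a b e) d c"
    using assms by (simp only: br_assoc br_comm[of c d e])
  also have "\<dots> = br c d (br a b e)"
    using assms by (intro br_comm br_closed)
  also have "\<dots> = br (br a d c) b e"
    using assms by (simp only: br_assoc br_comm[of a d c])
  also have "\<dots> = br a d (br c b e)"
    using assms by (simp only: br_assoc)
  finally show ?thesis .
qed

lemma br_swap_pairs:
  assumes "a \<in> H" "b \<in> H" "c \<in> H" "d \<in> H" "e \<in> H"
  shows "br a b (br c d e) = br c d (br a b e)"
proof -
  have "br a b (br c d e) = br (br a d c) b e"
    using assms by (simp only: br_swap_neg[of a b c d e] br_assoc)
  also have "\<dots> = br c d (br a b e)"
    using assms by (simp only: br_comm[of a d c] br_assoc)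
  finally show ?thesis .
qed

text \<open>This is the sign rule \<open>a - (b - c + d) + e = a - d + c - b + e\<close>.\<close>

lemma br_br_middle:
  assumes "a \<in> H" "b \<in> H" "c \<in> H" "d \<in> H" "e \<in> H"
  shows "br a (br b c d) e = br a d (br c b e)"
proof -
  \<comment> \<open>Writing \<open>e\<close> as a bracket that starts with \<open>[b, c, d]\<close> lets the middle entry cancel.\<close>
  have "br (br b c d) d (br c b e) = e"
    using assms by (metis br_assoc br_closed br_left br_right)
  then have "br a (br b c d) e = br a (br b c d) (br (br b c d) d (br c b e))"
    by simp
  also have "\<dots> = br (br a (br b c d) (br b c d)) d (br c b e)"
    using assms by (simp only: br_assoc br_closed)
  also have "\<dots> = br a d (br c b e)"
    using assms by (simp only: br_closed br_right)
  finally show ?thesis .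
qed

lemma br_medial:
  assumes "a \<in> H" "b \<in> H" "c \<in> H" "d \<in> H" "e \<in> H" "f \<in> H" "g \<in> H" "h \<in> H" "i \<in> H"
  shows "br (br a b c) (br d e f) (br g h i) = br (br a d g) (br b e h) (br c f i)"
proof -
  have "br (br a b c) (br d e f) (br g h i) = br a b (br c f (br e d (br g h i)))"
    using assms by (simp only: br_br_middle br_assoc br_closed)
  also have "\<dots> = br a b (br e d (br c f (br g h i)))"
    using assms by (simp only: br_swap_pairs[of c f e d] br_closed)
  also have "\<dots> = br a d (br e b (br c f (br g h i)))"
    using assms by (simp only: br_swap_neg[of a b e d] br_closed)
  also have "\<dots> = br a d (br e b (br g h (br c f i)))"
    using assms by (simp only: br_swap_pairs[of c f g h i])
  also have "\<dots> = br a d (br g h (br e b (br c f i)))"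
    using assms by (simp only: br_swap_pairs[of e b g h] br_closed)
  also have "\<dots> = br (br a d g) (br b e h) (br c f i)"
    using assms by (simp only: br_br_middle br_assoc br_closed)
  finally show ?thesis .
qed

end

context two_abelian_heaps
begin

lemma il_D [simp]: "a \<in> A \<Longrightarrow> il a \<in> D"
  using heap_hom_inl by (simp add: heap_hom_def)

lemma ir_D [simp]: "b \<in> B \<Longrightarrow> ir b \<in> D"
  using heap_hom_inr by (simp add: heap_hom_def)

text \<open>The universal property of the coproduct with a parameter from \<open>P\<close>. That \<open>h p x\<close> is a homomorphism
  in \<open>p\<close> is shown by induction on \<open>x\<close>, the medial law giving the case of a bracket. Of the parameter
  heap only closure under its operation is needed.\<close>

lemma dsum_hom_exists_param:
  assumes C: "abelian_heap C brC"
    and P_closed: "\<And>p q r. \<lbrakk>p \<in> P; q \<in> P; r \<in> P\<rbrakk> \<Longrightarrow> brP p q r \<in> P"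
    and f: "\<And>p. p \<in> P \<Longrightarrow> heap_hom A brA C brC (f p)"
    and g: "\<And>p. p \<in> P \<Longrightarrow> heap_hom B brB C brC (g p)"
    and f_param: "\<And>a. a \<in> A \<Longrightarrow> heap_hom P brP C brC (\<lambda>p. f p a)"
    and g_param: "\<And>b. b \<in> B \<Longrightarrow> heap_hom P brP C brC (\<lambda>p. g p b)"
  obtains h where "\<And>p. p \<in> P \<Longrightarrow> heap_hom D brD C brC (h p)"
    and "\<And>p a. \<lbrakk>p \<in> P; a \<in> A\<rbrakk> \<Longrightarrow> h p (il a) = f p a"
    and "\<And>p b. \<lbrakk>p \<in> P; b \<in> B\<rbrakk> \<Longrightarrow> h p (ir b) = g p b"
    and "\<And>x. x \<in> D \<Longrightarrow> heap_hom P brP C brC (\<lambda>p. h p x)"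
proof -
  interpret C: abelian_heap C brC by (rule C)
  have "\<forall>p\<in>P. \<exists>h. heap_hom D brD C brC h \<and> (\<forall>a\<in>A. h (il a) = f p a) \<and> (\<forall>b\<in>B. h (ir b) = g p b)"
    using dsum_hom_exists[OF C f g] by blast
  then obtain h where h: "\<And>p. p \<in> P \<Longrightarrow> heap_hom D brD C brC (h p)"
    and hl: "\<And>p a. \<lbrakk>p \<in> P; a \<in> A\<rbrakk> \<Longrightarrow> h p (il a) = f p a"
    and hr: "\<And>p b. \<lbrakk>p \<in> P; b \<in> B\<rbrakk> \<Longrightarrow> h p (ir b) = g p b"
    by metis
  have "heap_hom P brP C brC (\<lambda>p. h p x)" if "x \<in> D" for x
    using that
  proof (induction rule: dsum_induct)
    case (inl a)
    then show ?case using f_param[of a] by (simp add: heap_hom_def hl P_closed)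
  next
    case (inr b)
    then show ?case using g_param[of b] by (simp add: heap_hom_def hr P_closed)
  next
    case (br x y z)
    then show ?case using h by (simp add: heap_hom_def P_closed C.br_closed C.br_medial)
  qed
  with h hl hr show ?thesis by (rule that)
qed

text \<open>The images of the two summands, which generate the coproduct as a heap.\<close>

definition generators :: "('a + 'b) hterm set set"
  where "generators = il ` A \<union> ir ` B"

lemma generators_D: "x \<in> generators \<Longrightarrow> x \<in> D"
  by (auto simp: generators_def)

lemma generators_induct [consumes 1, case_names gen br]:
  assumes "x \<in> D" and "\<And>x. x \<in> generators \<Longrightarrow> P x"
    and "\<And>x y z. \<lbrakk>x \<in> D; y \<in> D; z \<in> D; P x; P y; P z\<rbrakk> \<Longrightarrow> P (brD x y z)"
  shows "P x"
  using assms by (induction rule: dsum_induct) (auto simp: generators_def)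

lemma mul_eq_on_generators:
  assumes m: "distributive_heap D brD m" and m': "distributive_heap D brD m'"
    and eq: "\<And>x y. \<lbrakk>x \<in> generators; y \<in> generators\<rbrakk> \<Longrightarrow> m x y = m' x y"
    and "x \<in> D" "y \<in> D"
  shows "m x y = m' x y"
proof -
  interpret m: distributive_heap D brD m by (rule m)
  interpret m': distributive_heap D brD m' by (rule m')
  have *: "m x y = m' x y" if "x \<in> generators" "y \<in> D" for x y
    using that(2) by (induction rule: generators_induct)
      (simp_all add: that(1) eq generators_D m.distrib_left m'.distrib_left)
  show ?thesis
    using \<open>x \<in> D\<close> by (induction rule: generators_induct)
      (simp_all add: * \<open>y \<in> D\<close> m.distrib_right m'.distrib_right)
qed

text \<open>The three inductions pass from generators to arbitrary elements in the third, the second and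
  the first factor in turn.\<close>

lemma truss_if_assoc_on_generators:
  assumes m: "distributive_heap D brD m"
    and assoc: "\<And>x y u. \<lbrakk>x \<in> generators; y \<in> generators; u \<in> generators\<rbrakk>
      \<Longrightarrow> m (m x y) u = m x (m y u)"
  shows "truss D brD m"
proof -
  interpret m: distributive_heap D brD m by (rule m)
  have 1: "m (m x y) u = m x (m y u)" if "x \<in> generators" "y \<in> generators" "u \<in> D" for x y u
    using that(3) by (induction rule: generators_induct)
      (simp_all add: that(1,2) assoc generators_D m.mul_closed m.distrib_left)
  have 2: "m (m x y) u = m x (m y u)" if "x \<in> generators" "y \<in> D" "u \<in> D" for x y u
    using that(2) by (induction rule: generators_induct)
      (simp_all add: that(1,3) 1 generators_D m.mul_closed m.distrib_left m.distrib_right)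
  show ?thesis
  proof
    fix x y u assume "x \<in> D" "y \<in> D" "u \<in> D"
    then show "m (m x y) u = m x (m y u)"
      by (induction rule: generators_induct)
        (simp_all add: 2 m.mul_closed m.distrib_right)
  qed
qed

end

theorem lemma3p13:
  fixes T :: "'a set" and brT :: "'a \<Rightarrow> 'a \<Rightarrow> 'a \<Rightarrow> 'a" and mulT :: "'a \<Rightarrow> 'a \<Rightarrow> 'a"
    and z :: 'b and brZ :: "'b \<Rightarrow> 'b \<Rightarrow> 'b \<Rightarrow> 'b" and mulZ :: "'b \<Rightarrow> 'b \<Rightarrow> 'b"
  assumes "truss T brT mulT" and "truss {z} brZ mulZ"
  shows "let D = dsum T brT {z} brZ;
             brD = dsum_br T brT {z} brZ;
             \<iota> = dsum_inl T brT {z} brZ;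
             o0 = dsum_inr T brT {z} brZ z;
             extends = (\<lambda>m. distributive_heap D brD m \<and>
               (\<forall>t\<in>T. m o0 (\<iota> t) = o0 \<and> m (\<iota> t) o0 = o0) \<and>
               (\<forall>t\<in>T. \<forall>t'\<in>T. m (\<iota> t) (\<iota> t') = \<iota> (mulT t t')) \<and>
               m o0 o0 = o0)
         in \<exists>m. extends m \<and>
              (\<forall>m'. extends m' \<longrightarrow> (\<forall>x\<in>D. \<forall>y\<in>D. m' x y = m x y)) \<and>
              ring_type_truss D brD m \<and> absorber D m o0"
proof -
  interpret T: truss T brT mulT by (rule assms(1))
  interpret Z: truss "{z}" brZ mulZ by (rule assms(2))
  interpret two_abelian_heaps T brT "{z}" brZ by unfold_locales
  interpret D: abelian_heap D brD by (rule abelian_heap_dsum)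
  let ?o = "ir z"
  define extends where "extends m \<longleftrightarrow> distributive_heap D brD m \<and>
      (\<forall>t\<in>T. m ?o (il t) = ?o \<and> m (il t) ?o = ?o) \<and>
      (\<forall>t\<in>T. \<forall>t'\<in>T. m (il t) (il t') = il (mulT t t')) \<and> m ?o ?o = ?o" for m
  have gens: "generators = insert ?o (il ` T)"
    by (auto simp: generators_def)
  have const: "heap_hom X brX D brD (\<lambda>_. ?o)" for X :: "'c set" and brX
    by (simp add: heap_hom_def D.br_right)
  have lmul: "heap_hom T brT D brD (\<lambda>t'. il (mulT t t'))"
    and rmul: "heap_hom T brT D brD (\<lambda>t'. il (mulT t' t))" if "t \<in> T" for t
    using that heap_hom_inl
    by (simp_all add: heap_hom_def T.mul_closed T.distrib_left T.distrib_right)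
  \<comment> \<open>\<open>L t\<close> is left multiplication by \<open>t\<close> on the whole coproduct.\<close>
  obtain L where L: "\<And>t. t \<in> T \<Longrightarrow> heap_hom D brD D brD (L t)"
    and L_il: "\<And>t t'. \<lbrakk>t \<in> T; t' \<in> T\<rbrakk> \<Longrightarrow> L t (il t') = il (mulT t t')"
    and L_o: "\<And>t b. \<lbrakk>t \<in> T; b \<in> {z}\<rbrakk> \<Longrightarrow> L t (ir b) = ?o"
    and L_param: "\<And>y. y \<in> D \<Longrightarrow> heap_hom T brT D brD (\<lambda>t. L t y)"
    using dsum_hom_exists_param[where f = "\<lambda>t t'. il (mulT t t')" and g = "\<lambda>_ _. ?o",
        OF abelian_heap_dsum T.br_closed lmul const rmul const] by blast
  \<comment> \<open>\<open>R y\<close> is right multiplication by \<open>y\<close>: it takes \<open>t\<close> to \<open>L t y\<close> and \<open>0\<close> to \<open>0\<close>.\<close>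
  obtain R where R: "\<And>y. y \<in> D \<Longrightarrow> heap_hom D brD D brD (R y)"
    and R_il: "\<And>y t. \<lbrakk>y \<in> D; t \<in> T\<rbrakk> \<Longrightarrow> R y (il t) = L t y"
    and R_o: "\<And>y b. \<lbrakk>y \<in> D; b \<in> {z}\<rbrakk> \<Longrightarrow> R y (ir b) = ?o"
    and R_param: "\<And>x. x \<in> D \<Longrightarrow> heap_hom D brD D brD (\<lambda>y. R y x)"
    using dsum_hom_exists_param[where f = "\<lambda>y t. L t y" and g = "\<lambda>_ _. ?o",
        OF abelian_heap_dsum D.br_closed L_param const L const] by blast
  define m where "m x y = R y x" for x y
  have m: "distributive_heap D brD m"
    by unfold_locales (use R R_param in \<open>simp_all add: m_def heap_hom_def\<close>)
  have vals: "m ?o ?o = ?o" "\<And>t. t \<in> T \<Longrightarrow> m ?o (il t) = ?o" "\<And>t. t \<in> T \<Longrightarrow> m (il t) ?o = ?o"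
    "\<And>t t'. \<lbrakk>t \<in> T; t' \<in> T\<rbrakk> \<Longrightarrow> m (il t) (il t') = il (mulT t t')"
    by (simp_all add: m_def R_o R_il L_il L_o)
  have ext: "extends m"
    unfolding extends_def using m vals by blast
  have uniq: "m' x y = m x y" if "extends m'" "x \<in> D" "y \<in> D" for m' x y
  proof (rule mul_eq_on_generators[OF _ m _ that(2,3)])
    show "distributive_heap D brD m'"
      using that(1) by (simp add: extends_def)
    show "m' u v = m u v" if "u \<in> generators" "v \<in> generators" for u v
      using \<open>extends m'\<close> that by (auto simp: gens extends_def vals)
  qed
  have truss: "truss D brD m"
    by (rule truss_if_assoc_on_generators[OF m]) (auto simp: gens vals T.mul_closed T.mul_assoc)
  interpret m: truss D brD m by (rule truss)
  have "m x ?o = ?o \<and> m ?o x = ?o" if "x \<in> D" for x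
    using that by (induction rule: dsum_induct)
      (simp_all add: vals m.distrib_left m.distrib_right D.br_right)
  then have abs: "absorber D m ?o"
    by (simp add: absorber_def)
  then have "ring_type_truss D brD m"
    by unfold_locales blast
  with ext uniq abs show ?thesis
    unfolding Let_def extends_def by blast
qed

end
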